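(* Let $(G,u)$ be a unital Abelian $\ell$-group, let $\mathcal{B}$ be a Boolean algebra, and let $\mu:\mathcal{B}\to G$ be positive, finitely additive on disjoint joins, strictly positive, normalized by $\mu(1)=u$, and interval divisible. For all $x,y\in\Gamma(G,u)$, $$x\star y=\left[(x+y-u)\vee0,\ x\wedge y\right]_G.$$
   Context: A unital Abelian $\ell$-group $(G,u)$ is an Abelian lattice-ordered group $G$ with a strong order unit $u$. $\Gamma(G,u)=\{g\in G:0\le g\le u\}$ and $[r,s]_G=\{g\in G:r\le g\le s\}$. For $\mu:\mathcal{B}\to G$: positive means $\mu(a)\ge0$ for all $a$; finitely additive means $\mu(a\vee b)=\mu(a)+\mu(b)$ whenever $a\wedge b=0$; strictly positive means $\mu(a)=0$ implies $a=0$; interval divisible means that whenever $g\in G$ and $0\le g\le\mu(a)$ there is $b\le a$ in $\mathcal{B}$ with $\mu(b)=g$. For $x,y\in\Gamma(G,u)$, $x\star y:=\{\mu(a\wedge b):a,b\in\mathcal{B},\ \mu(a)=x,\ \mu(b)=y\}$. On $G$, $\wedge,\vee$ denote the lattice operations; on $\mathcal{B}$, the Boolean operations. *)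

theory Defs
  imports "HOL-Library.Lattice_Algebras"
begin

text \<open>
  Abelian lattice-ordered groups are the types of class \<^class>\<open>lattice_ab_group_add\<close>, Boolean
  algebras those of class \<^class>\<open>boolean_algebra\<close> (which admits the one-element algebra).
  The closed interval of an l-group between r and s is the library's \<open>{r..s}\<close>.
\<close>

text \<open>The sum below is the n-fold multiple of u.\<close>

definition strong_unit :: "'g::lattice_ab_group_add \<Rightarrow> bool" where
  "strong_unit u \<longleftrightarrow> 0 \<le> u \<and> (\<forall>g. \<exists>n::nat. g \<le> (\<Sum>i<n. u))"

definition Gam :: "'g::lattice_ab_group_add \<Rightarrow> 'g set" where
  "Gam u = {0..u}"

definition positive :: "('b::boolean_algebra \<Rightarrow> 'g::lattice_ab_group_add) \<Rightarrow> bool" where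
  "positive \<mu> \<longleftrightarrow> (\<forall>a. 0 \<le> \<mu> a)"

definition finitely_additive :: "('b::boolean_algebra \<Rightarrow> 'g::lattice_ab_group_add) \<Rightarrow> bool" where
  "finitely_additive \<mu> \<longleftrightarrow> (\<forall>a b. inf a b = bot \<longrightarrow> \<mu> (sup a b) = \<mu> a + \<mu> b)"

definition strictly_positive :: "('b::boolean_algebra \<Rightarrow> 'g::lattice_ab_group_add) \<Rightarrow> bool" where
  "strictly_positive \<mu> \<longleftrightarrow> (\<forall>a. \<mu> a = 0 \<longrightarrow> a = bot)"

definition interval_divisible :: "('b::boolean_algebra \<Rightarrow> 'g::lattice_ab_group_add) \<Rightarrow> bool" where
  "interval_divisible \<mu> \<longleftrightarrow> (\<forall>a g. 0 \<le> g \<and> g \<le> \<mu> a \<longrightarrow> (\<exists>b. b \<le> a \<and> \<mu> b = g))"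

definition meet_values :: "('b::boolean_algebra \<Rightarrow> 'g::lattice_ab_group_add) \<Rightarrow> 'g \<Rightarrow> 'g \<Rightarrow> 'g set" where
  "meet_values \<mu> x y = {\<mu> (inf a b) | a b. \<mu> a = x \<and> \<mu> b = y}"

end

theory Submission
  imports Defs
begin

text \<open>
  Inclusion of the left side is the modular law for \<open>\<mu>\<close>. Conversely, for \<open>g\<close> in the interval,
  split an element \<open>a\<close> of measure \<open>x\<close>: choose \<open>c\<close> below \<open>a\<close> of measure \<open>g\<close> and \<open>d\<close> below the
  complement of \<open>a\<close> of measure \<open>y - g\<close>, which is possible since \<open>y - g \<le> u - x\<close>; then \<open>a\<close> and
  \<open>b = sup c d\<close> witness \<open>g\<close>.
\<close>

lemma finitely_additiveD:
  "finitely_additive \<mu> \<Longrightarrow> inf a b = bot \<Longrightarrow> \<mu> (sup a b) = \<mu> a + \<mu> b"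
  by (simp add: finitely_additive_def)

lemma interval_divisibleE:
  assumes "interval_divisible \<mu>" "0 \<le> g" "g \<le> \<mu> a"
  obtains b where "b \<le> a" "\<mu> b = g"
  using assms by (auto simp: interval_divisible_def)

text \<open>The meets of \<open>a\<close> with \<open>b\<close> and with \<open>- b\<close> are
  disjoint and join to \<open>a\<close>. Monotonicity, the modular law and the measure of a
  complement all come from this splitting.\<close>

lemma finitely_additive_split:
  assumes "finitely_additive \<mu>"
  shows "\<mu> a = \<mu> (inf a b) + \<mu> (inf a (- b))"
proof -
  have "inf (inf a b) (inf a (- b)) = inf a (inf b (- b))"
    by (simp only: inf_assoc inf_left_commute inf_left_idem)
  then have disj: "inf (inf a b) (inf a (- b)) = bot"
    by simp
  have "sup (inf a b) (inf a (- b)) = a"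
    by (simp flip: inf_sup_distrib1)
  then show ?thesis
    using finitely_additiveD[OF assms disj] by simp
qed

lemma finitely_additive_mono:
  assumes "positive \<mu>" "finitely_additive \<mu>" "a \<le> b"
  shows "\<mu> a \<le> \<mu> b"
  using finitely_additive_split[OF assms(2), of b a] assms(1,3)
  by (simp add: positive_def inf.absorb2)

text \<open>Splitting both \<open>sup a b\<close> and \<open>b\<close> along \<open>a\<close> leaves
  the same remainder \<open>inf b (- a)\<close>, which cancels.\<close>

lemma finitely_additive_modular:
  assumes "finitely_additive \<mu>"
  shows "\<mu> (sup a b) + \<mu> (inf a b) = \<mu> a + \<mu> b"
proof -
  have "inf (sup a b) (- a) = inf b (- a)"
    by (simp add: inf_sup_distrib2)
  then have "\<mu> (sup a b) = \<mu> a + \<mu> (inf b (- a))"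
    using finitely_additive_split[OF assms, of "sup a b" a] by (simp add: inf.absorb2)
  moreover have "\<mu> b = \<mu> (inf a b) + \<mu> (inf b (- a))"
    using finitely_additive_split[OF assms, of b a] by (simp add: inf.commute)
  ultimately show ?thesis
    by (simp add: ac_simps)
qed

lemma meet_values_subset:
  assumes "positive \<mu>" "finitely_additive \<mu>"
  shows "meet_values \<mu> x y \<subseteq> {sup (x + y - \<mu> top) 0 .. inf x y}"
proof
  fix g
  assume "g \<in> meet_values \<mu> x y"
  then obtain a b where ab: "g = \<mu> (inf a b)" "\<mu> a = x" "\<mu> b = y"
    by (auto simp: meet_values_def)
  have "x + y = \<mu> (sup a b) + g"
    using finitely_additive_modular[OF assms(2), of a b] ab by simp
  \<comment> \<open>Bounding the join by \<open>top\<close> turns the modular law into the lower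
    bound on \<open>g\<close>.\<close>
  also have "\<dots> \<le> \<mu> top + g"
    by (intro add_right_mono finitely_additive_mono assms top_greatest)
  finally have "x + y - \<mu> top \<le> g"
    by (simp add: diff_le_eq add.commute)
  moreover have "0 \<le> g"
    using assms(1) ab by (simp add: positive_def)
  moreover have "g \<le> x" "g \<le> y"
    using finitely_additive_mono[OF assms, of "inf a b"] ab by auto
  ultimately show "g \<in> {sup (x + y - \<mu> top) 0 .. inf x y}"
    by simp
qed

lemma interval_subset_meet_values:
  assumes add: "finitely_additive \<mu>" and div: "interval_divisible \<mu>"
    and x: "0 \<le> x" "x \<le> \<mu> top"
  shows "{sup (x + y - \<mu> top) 0 .. inf x y} \<subseteq> meet_values \<mu> x y"
proof
  fix g
  assume "g \<in> {sup (x + y - \<mu> top) 0 .. inf x y}"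
  then have g: "x + y - \<mu> top \<le> g" "0 \<le> g" "g \<le> x" "g \<le> y"
    by auto
  \<comment> \<open>Divisibility is applied to \<open>top\<close> here, so every value between 0 and
    \<open>\<mu> top\<close> is attained.\<close>
  obtain a where a: "\<mu> a = x"
    using interval_divisibleE[OF div x] by blast
  obtain c where c: "c \<le> a" "\<mu> c = g"
    using interval_divisibleE[OF div \<open>0 \<le> g\<close>] \<open>g \<le> x\<close> a by blast
  have "\<mu> top = x + \<mu> (- a)"
    using finitely_additive_split[OF add, of top a] a by simp
  \<comment> \<open>Since \<open>- a\<close> has measure \<open>\<mu> top - x\<close>, this is the
    lower bound on \<open>g\<close> rearranged.\<close>
  then have "y - g \<le> \<mu> (- a)"
    using g(1) by (simp add: algebra_simps)
  then obtain d where d: "d \<le> - a" "\<mu> d = y - g"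
    using interval_divisibleE[OF div, of "y - g" "- a"] g(4) by auto
  \<comment> \<open>Disjointness of \<open>d\<close> from \<open>a\<close> serves twice:
    \<open>d\<close> is then disjoint from \<open>c\<close>, so measures add up to \<open>y\<close>,
    and \<open>d\<close> contributes nothing to the meet of \<open>a\<close> with
    \<open>sup c d\<close>.\<close>
  have ad: "inf a d = bot"
    using d(1) by (metis inf_shunt compl_le_swap1 inf.commute)
  then have "inf c d = bot"
    using c(1) by (metis inf.absorb1 inf.assoc inf_bot_right)
  then have "\<mu> (sup c d) = y"
    using finitely_additiveD[OF add] c(2) d(2) by simp
  moreover have "inf a (sup c d) = c"
    using ad c(1) by (simp add: inf_sup_distrib1 inf.absorb2)
  ultimately show "g \<in> meet_values \<mu> x y"
    using a c(2) unfolding meet_values_def by (intro CollectI exI[of _ a] exI[of _ "sup c d"]) simp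
qed

theorem theorem9:
  fixes u :: "'g::lattice_ab_group_add"
    and \<mu> :: "'b::boolean_algebra \<Rightarrow> 'g"
    and x y :: 'g
  assumes "strong_unit u"
    and "positive \<mu>"
    and "finitely_additive \<mu>"
    and "strictly_positive \<mu>"
    and "\<mu> top = u"
    and "interval_divisible \<mu>"
    and "x \<in> Gam u"
    and "y \<in> Gam u"
  shows "meet_values \<mu> x y = {sup (x + y - u) 0 .. inf x y}"
  using meet_values_subset[OF assms(2,3), of x y]
    interval_subset_meet_values[OF assms(3,6), of x y] assms(5,7)
  by (auto simp: Gam_def)

end
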